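(* Let $n\ge 1$ and let $a,b,x,y$ belong to $\mathbb{C}_n^\perp\subset A_n$. Then in $A_{n+1}$ the product $\{a,b\}\{x,y\}$ equals $$\sqrt{2}\,\big\{\pi_{\mathbb{C}}^\perp(ax),\,\pi_{\mathbb{C}}^\perp(by)\big\}+\tilde\pi_{\mathbb{C}}(xa+by)+\tilde\pi_{\mathbb{C}}(ay-xb)\,(0,i_n).$$
   Context: The Cayley-Dickson algebras $A_n$ are real algebras with involution defined inductively: $A_0=\mathbb{R}$ with trivial conjugation, and $A_n=A_{n-1}\times A_{n-1}$ additively, with $(a,b)^*=(a^*,-b)$ and $(a,b)(c,d)=(ac-d^*b,\;da+bc^* )$. For $n\ge 1$ put $i_n=(0,1)\in A_n$, and let $\mathbb{C}_n$ be the $\mathbb{R}$-linear span of $1=(1,0)$ and $i_n$. The real inner product is $\langle a,b\rangle_{\mathbb{R}}=\mathrm{Re}(ab^* )$, where $\mathrm{Re}(x)=\frac12(x+x^* )$; $\mathbb{C}_n^\perp$ is the orthogonal complement of $\mathbb{C}_n$ in $A_n$. For $a,b\in\mathbb{C}_n^\perp$, $\{a,b\}$ denotes the element $\frac{1}{\sqrt2}\big(a+b,\;i_n(-a+b)\big)$ of $A_{n+1}$. $\pi_{\mathbb{C}}$ and $\pi_{\mathbb{C}}^\perp$ denote the orthogonal projections of $A_n$ onto $\mathbb{C}_n$ and onto $\mathbb{C}_n^\perp$. $\tilde\pi_{\mathbb{C}}:A_n\to\mathbb{C}_{n+1}$ is the composition of $\pi_{\mathbb{C}}:A_n\to\mathbb{C}_n$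 with the $\mathbb{R}$-linear map $\mathbb{C}_n\to\mathbb{C}_{n+1}$ taking $1\mapsto 1$ and $i_n\mapsto i_{n+1}$. The element $(0,i_n)$ is in $A_{n+1}=A_n\times A_n$. *)

theory Defs
  imports Complex_Main
begin

text \<open>
  The type \<open>cd\<close> contains all iterated pairs of reals; the Cayley-Dickson algebra \<open>A\<^sub>n\<close> is the set
  \<open>cd_alg n\<close> of the full binary trees of depth \<open>n\<close>. The operations are the componentwise and
  Cayley-Dickson ones. They are intended for two trees of the same shape only and are
  unspecified otherwise; in particular zero and one depend on \<open>n\<close>.
\<close>

datatype cd = CDReal real | CDPair cd cd

primrec cd_alg :: "nat \<Rightarrow> cd set" where
  "cd_alg 0 = range CDReal"
| "cd_alg (Suc n) = {CDPair a b | a b. a \<in> cd_alg n \<and> b \<in> cd_alg n}"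

primrec cd_zero :: "nat \<Rightarrow> cd" where
  "cd_zero 0 = CDReal 0"
| "cd_zero (Suc n) = CDPair (cd_zero n) (cd_zero n)"

primrec cd_one :: "nat \<Rightarrow> cd" where
  "cd_one 0 = CDReal 1"
| "cd_one (Suc n) = CDPair (cd_one n) (cd_zero n)"

instantiation cd :: "{plus, minus, uminus, scaleR}"
begin

fun plus_cd :: "cd \<Rightarrow> cd \<Rightarrow> cd" where
  "CDReal r + CDReal s = CDReal (r + s)"
| "CDPair a b + CDPair c d = CDPair (a + c) (b + d)"

primrec uminus_cd :: "cd \<Rightarrow> cd" where
  "- CDReal r = CDReal (- r)"
| "- CDPair a b = CDPair (- a) (- b)"

definition minus_cd :: "cd \<Rightarrow> cd \<Rightarrow> cd" where
  "x - y = x + (- y)" for x y :: cd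

primrec scaleR_cd :: "real \<Rightarrow> cd \<Rightarrow> cd" where
  "t *\<^sub>R CDReal r = CDReal (t * r)"
| "t *\<^sub>R CDPair a b = CDPair (t *\<^sub>R a) (t *\<^sub>R b)"

instance ..

end

primrec cd_conj :: "cd \<Rightarrow> cd" where
  "cd_conj (CDReal r) = CDReal r"
| "cd_conj (CDPair a b) = CDPair (cd_conj a) (- b)"

lemma size_uminus_cd [simp]: "size (- x) = size (x :: cd)"
  by (induction x) auto

lemma size_cd_conj [simp]: "size (cd_conj x) = size x"
  by (induction x) auto

instantiation cd :: times
begin

function (sequential) times_cd :: "cd \<Rightarrow> cd \<Rightarrow> cd" where
  "CDReal r * CDReal s = CDReal (r * s)"
| "CDPair a b * CDPair c d = CDPair (a * c - cd_conj d * b) (d * a + b * cd_conj c)"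
| "CDReal r * CDPair c d = undefined"
| "CDPair a b * CDReal s = undefined"
  by pat_completeness auto
termination
  by (relation "measure (\<lambda>(x, y). size x + size y)") auto

instance ..

end

text \<open>The element \<open>i\<^sub>n = (0, 1)\<close>, for \<open>n \<ge> 1\<close> only.\<close>

fun cd_i :: "nat \<Rightarrow> cd" where
  "cd_i (Suc n) = CDPair (cd_zero n) (cd_one n)"

definition cd_Cn :: "nat \<Rightarrow> cd set" where
  "cd_Cn n = {r *\<^sub>R cd_one n + s *\<^sub>R cd_i n | r s. True}"

definition cd_Re :: "cd \<Rightarrow> cd" where
  "cd_Re x = (1 / 2) *\<^sub>R (x + cd_conj x)"

text \<open>
  \<open>cd_Re x\<close> is an element of \<open>A\<^sub>n\<close>; the inner product is its value under the identification of
  the multiples of \<open>cd_one n\<close> with the reals.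
\<close>

definition cd_inner :: "nat \<Rightarrow> cd \<Rightarrow> cd \<Rightarrow> real" where
  "cd_inner n a b = (THE r. cd_Re (a * cd_conj b) = r *\<^sub>R cd_one n)"

definition cd_Cperp :: "nat \<Rightarrow> cd set" where
  "cd_Cperp n = {x \<in> cd_alg n. \<forall>c \<in> cd_Cn n. cd_inner n x c = 0}"

definition cd_orth_proj :: "nat \<Rightarrow> cd set \<Rightarrow> cd \<Rightarrow> cd" where
  "cd_orth_proj n S x = (THE p. p \<in> S \<and> (\<forall>s \<in> S. cd_inner n (x - p) s = 0))"

definition cd_piC :: "nat \<Rightarrow> cd \<Rightarrow> cd" where
  "cd_piC n = cd_orth_proj n (cd_Cn n)"

definition cd_piCperp :: "nat \<Rightarrow> cd \<Rightarrow> cd" where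
  "cd_piCperp n = cd_orth_proj n (cd_Cperp n)"

text \<open>
  \<open>cd_C_shift n\<close> is the linear map \<open>\<complex>\<^sub>n \<rightarrow> \<complex>\<^sub>n\<^sub>+\<^sub>1\<close> with \<open>1 \<mapsto> 1\<close> and \<open>i\<^sub>n \<mapsto> i\<^sub>n\<^sub>+\<^sub>1\<close>.
\<close>

definition cd_C_shift :: "nat \<Rightarrow> cd \<Rightarrow> cd" where
  "cd_C_shift n c = (THE d. \<exists>r s. c = r *\<^sub>R cd_one n + s *\<^sub>R cd_i n \<and>
     d = r *\<^sub>R cd_one (Suc n) + s *\<^sub>R cd_i (Suc n))"

definition cd_piC_tilde :: "nat \<Rightarrow> cd \<Rightarrow> cd" where
  "cd_piC_tilde n x = cd_C_shift n (cd_piC n x)"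

definition cd_brace :: "nat \<Rightarrow> cd \<Rightarrow> cd \<Rightarrow> cd" where
  "cd_brace n a b = (1 / sqrt 2) *\<^sub>R CDPair (a + b) (cd_i n * (- a + b))"

end

theory Submission
  imports Defs
begin

text \<open>
  Write \<open>n = m + 1\<close>. An element \<open>(p, q)\<close> of \<open>A\<^sub>n\<close> lies in the orthogonal complement of \<open>\<complex>\<^sub>n\<close> iff \<open>p\<close> and
  \<open>q\<close> are imaginary, and its projection to \<open>\<complex>\<^sub>n\<close> is \<open>(Re p, Re q)\<close>. So both sides of the
  formula are quadruples of elements of \<open>A\<^sub>m\<close>, bilinear in the imaginary components of \<open>a\<close>, \<open>b\<close>
  and of \<open>x\<close>, \<open>y\<close>. Since \<open>q p = (p q)\<^sup>*\<close> for imaginary \<open>p\<close>, \<open>q\<close>, every product in the opposite order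
  is \<open>q p = 2 Re (p q) - p q\<close>, and comparing coefficients suffices; no associativity is needed.
\<close>

section \<open>Linear structure\<close>

text \<open>
  The operations on \<open>cd\<close> satisfy the vector space laws only on each \<open>A\<^sub>n\<close>, so linear identities are
  checked on real coordinates, indexed by the path to a leaf.
\<close>

primrec cd_coord :: "cd \<Rightarrow> bool list \<Rightarrow> real" where
  "cd_coord (CDReal r) s = r"
| "cd_coord (CDPair a b) s = (if hd s then cd_coord a (tl s) else cd_coord b (tl s))"

text \<open>The leftmost leaf is the coefficient of \<open>cd_one n\<close>; by
  \<open>cd_add_conj\<close> below, \<open>cd_Re x\<close> is this multiple of one.\<close>

primrec cd_re :: "cd \<Rightarrow> real" where
  "cd_re (CDReal r) = r"
| "cd_re (CDPair a b) = cd_re a"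

lemma cd_alg_SucE:
  assumes "x \<in> cd_alg (Suc n)"
  obtains a b where "x = CDPair a b" "a \<in> cd_alg n" "b \<in> cd_alg n"
  using assms by auto

lemma cd_zero_closed [simp]: "cd_zero n \<in> cd_alg n"
  by (induction n) auto

lemma cd_one_closed [simp]: "cd_one n \<in> cd_alg n"
  by (induction n) auto

lemma cd_add_closed [simp]: "x \<in> cd_alg n \<Longrightarrow> y \<in> cd_alg n \<Longrightarrow> x + y \<in> cd_alg n"
  by (induction n arbitrary: x y) auto

lemma cd_uminus_closed [simp]: "x \<in> cd_alg n \<Longrightarrow> - x \<in> cd_alg n"
  by (induction n arbitrary: x) auto

lemma cd_diff_closed [simp]: "x \<in> cd_alg n \<Longrightarrow> y \<in> cd_alg n \<Longrightarrow> x - y \<in> cd_alg n"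
  for x y :: cd
  by (simp add: minus_cd_def)

lemma cd_scaleR_closed [simp]: "x \<in> cd_alg n \<Longrightarrow> t *\<^sub>R x \<in> cd_alg n"
  by (induction n arbitrary: x) auto

lemma cd_conj_closed [simp]: "x \<in> cd_alg n \<Longrightarrow> cd_conj x \<in> cd_alg n"
  by (induction n arbitrary: x) auto

lemma cd_mult_closed [simp]: "x \<in> cd_alg n \<Longrightarrow> y \<in> cd_alg n \<Longrightarrow> x * y \<in> cd_alg n"
  by (induction n arbitrary: x y) (auto elim!: cd_alg_SucE)

lemma cd_diff_Pair [simp]: "CDPair a b - CDPair c d = CDPair (a - c) (b - d)"
  by (simp add: minus_cd_def)

text \<open>True also for lists of the wrong length: surplus entries are ignored, and on a short
  list \<open>hd []\<close> is some fixed value, so the same leaf is read in every tree of the same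
  shape.\<close>

lemma cd_coord_add:
  "x \<in> cd_alg n \<Longrightarrow> y \<in> cd_alg n \<Longrightarrow> cd_coord (x + y) s = cd_coord x s + cd_coord y s"
  by (induction n arbitrary: x y s) auto

lemma cd_coord_scaleR [simp]: "cd_coord (t *\<^sub>R x) s = t * cd_coord x s"
  by (induction x arbitrary: s) auto

lemma cd_coord_uminus [simp]: "cd_coord (- x) s = - cd_coord x s"
  by (induction x arbitrary: s) auto

lemma cd_coord_zero [simp]: "cd_coord (cd_zero n) s = 0"
  by (induction n arbitrary: s) auto

lemma cd_coord_diff:
  "x \<in> cd_alg n \<Longrightarrow> y \<in> cd_alg n \<Longrightarrow> cd_coord (x - y) s = cd_coord x s - cd_coord y s"
  by (simp add: minus_cd_def cd_coord_add[where n = n])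

lemmas cd_coord_linear = cd_coord_add cd_coord_diff

text \<open>Membership in one common \<open>cd_alg n\<close> matters: coordinates do not see the
  shape, and all \<open>cd_zero n\<close> share the same ones.\<close>

lemma cd_eqI:
  "x \<in> cd_alg n \<Longrightarrow> y \<in> cd_alg n \<Longrightarrow> (\<And>s. cd_coord x s = cd_coord y s) \<Longrightarrow> x = y"
proof (induction n arbitrary: x y)
  case 0
  then show ?case by auto
next
  case (Suc n)
  from Suc.prems obtain a b c d where eq: "x = CDPair a b" "y = CDPair c d"
    and mem: "a \<in> cd_alg n" "b \<in> cd_alg n" "c \<in> cd_alg n" "d \<in> cd_alg n"
    by auto
  have "cd_coord a s = cd_coord c s" for s
    using Suc.prems(3)[of "True # s"] eq by simp
  moreover have "cd_coord b s = cd_coord d s" for s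
    using Suc.prems(3)[of "False # s"] eq by simp
  ultimately show ?case
    using Suc.IH mem eq by auto
qed

lemma cd_uminus_eq_scaleR: "- x = (- 1) *\<^sub>R x" for x :: cd
  by (induction x) auto

lemma cd_uminus_uminus [simp]: "- (- x) = x" for x :: cd
  by (induction x) auto

lemma cd_scaleR_scaleR [simp]: "s *\<^sub>R t *\<^sub>R x = (s * t) *\<^sub>R x" for x :: cd
  by (induction x) auto

lemma cd_scaleR_zero [simp]: "t *\<^sub>R cd_zero n = cd_zero n"
  by (rule cd_eqI[where n = n]) auto

lemma cd_zero_scaleR [simp]: "x \<in> cd_alg n \<Longrightarrow> 0 *\<^sub>R x = cd_zero n"
  by (rule cd_eqI[where n = n]) auto

section \<open>Conjugation, products and real parts\<close>

lemma cd_conj_add: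
  "x \<in> cd_alg n \<Longrightarrow> y \<in> cd_alg n \<Longrightarrow> cd_conj (x + y) = cd_conj x + cd_conj y"
proof (induction n arbitrary: x y)
  case 0
  then show ?case by auto
next
  case (Suc n)
  have "- (b + d) = - b + - d" if "b \<in> cd_alg n" "d \<in> cd_alg n" for b d :: cd
    by (rule cd_eqI[where n = n]) (use that in \<open>simp_all add: cd_coord_add[where n = n]\<close>)
  with Suc show ?case by (auto elim!: cd_alg_SucE)
qed

lemma cd_conj_scaleR [simp]: "cd_conj (t *\<^sub>R x) = t *\<^sub>R cd_conj x"
  by (induction x) (simp_all add: cd_uminus_eq_scaleR)

lemma cd_conj_uminus [simp]: "cd_conj (- x) = - cd_conj x"
  by (simp add: cd_uminus_eq_scaleR)

lemma cd_conj_diff: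
  "x \<in> cd_alg n \<Longrightarrow> y \<in> cd_alg n \<Longrightarrow> cd_conj (x - y) = cd_conj x - cd_conj y"
  by (simp add: minus_cd_def cd_conj_add[where n = n])

lemma cd_conj_conj [simp]: "cd_conj (cd_conj x) = x"
  by (induction x) auto

lemma cd_conj_zero [simp]: "cd_conj (cd_zero n) = cd_zero n"
  by (induction n) (simp_all add: cd_uminus_eq_scaleR)

lemma cd_conj_one [simp]: "cd_conj (cd_one n) = cd_one n"
  by (induction n) (simp_all add: cd_uminus_eq_scaleR)

text \<open>Both halves go through one induction: in \<open>cd_conj d * b\<close> and
  \<open>d * a\<close> the factors change sides, so each half at depth \<open>Suc n\<close> uses the
  other at depth \<open>n\<close>. The same holds for \<open>cd_distrib\<close>.\<close>

lemma cd_mult_scaleR: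
  assumes "x \<in> cd_alg n" "y \<in> cd_alg n"
  shows "(t *\<^sub>R x) * y = t *\<^sub>R (x * y) \<and> x * (t *\<^sub>R y) = t *\<^sub>R (x * y)"
  using assms
proof (induction n arbitrary: x y)
  case 0
  then show ?case by auto
next
  case (Suc n)
  have *: "t *\<^sub>R x + t *\<^sub>R y = t *\<^sub>R (x + y)" "t *\<^sub>R x - t *\<^sub>R y = t *\<^sub>R (x - y)"
    if "x \<in> cd_alg n" "y \<in> cd_alg n" for x y :: cd
    by (rule cd_eqI[where n = n];
        use that in \<open>simp add: cd_coord_linear[where n = n] algebra_simps\<close>)+
  from Suc show ?case
    by (elim cd_alg_SucE) (simp add: *)
qed

lemmas cd_scaleR_mult = cd_mult_scaleR[THEN conjunct1]
  and cd_mult_scaleR_right = cd_mult_scaleR[THEN conjunct2]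

text \<open>The case \<open>t = 0\<close> of the previous laws, zero being
  \<open>0 *\<^sub>R x\<close>.\<close>

lemma cd_mult_zero:
  assumes "x \<in> cd_alg n"
  shows "cd_zero n * x = cd_zero n" "x * cd_zero n = cd_zero n"
  using assms cd_scaleR_mult[of x n x 0] cd_mult_scaleR_right[of x n x 0] by simp_all

lemma cd_distrib:
  assumes "x \<in> cd_alg n" "y \<in> cd_alg n" "z \<in> cd_alg n"
  shows "(x + y) * z = x * z + y * z \<and> z * (x + y) = z * x + z * y"
  using assms
proof (induction n arbitrary: x y z)
  case 0
  then show ?case by (auto simp: algebra_simps)
next
  case (Suc n)
  obtain a b c d e f where eq: "x = CDPair a b" "y = CDPair c d" "z = CDPair e f"
    and mem: "a \<in> cd_alg n" "b \<in> cd_alg n" "c \<in> cd_alg n" "d \<in> cd_alg n" "e \<in> cd_alg n" "f \<in> cd_alg n"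
    using Suc.prems by auto
  \<comment> \<open>Expansion within each component interleaves the contributions of the two
    summands; these laws regroup them.\<close>
  have *: "(x + y) + (z + w) = (x + z) + (y + w)" "(x + y) - (z + w) = (x - z) + (y - w)"
    if "x \<in> cd_alg n" "y \<in> cd_alg n" "z \<in> cd_alg n" "w \<in> cd_alg n" for x y z w :: cd
    by (rule cd_eqI[where n = n];
        use that in \<open>simp add: cd_coord_linear[where n = n] algebra_simps\<close>)+
  show ?case
    using mem by (simp add: eq Suc.IH cd_conj_add[where n = n] *)
qed

lemmas cd_distrib_right = cd_distrib[THEN conjunct1]
  and cd_distrib_left = cd_distrib[THEN conjunct2]

lemma cd_mult_minus:
  assumes "x \<in> cd_alg n" "y \<in> cd_alg n"
  shows "(- x) * y = - (x * y)" "x * (- y) = - (x * y)"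
  using assms by (simp_all add: cd_uminus_eq_scaleR cd_scaleR_mult[where n = n]
      cd_mult_scaleR_right[where n = n])

lemma cd_diff_distrib:
  assumes "x \<in> cd_alg n" "y \<in> cd_alg n" "z \<in> cd_alg n"
  shows "(x - y) * z = x * z - y * z" "z * (x - y) = z * x - z * y"
  using assms by (simp_all add: minus_cd_def cd_distrib_right[where n = n]
      cd_distrib_left[where n = n] cd_mult_minus[where n = n])

lemma cd_add_zero:
  assumes "x \<in> cd_alg n"
  shows "x + cd_zero n = x" "cd_zero n + x = x" "x - cd_zero n = x" "cd_zero n - x = - x"
  by (rule cd_eqI[where n = n]; use assms in \<open>simp add: cd_coord_linear[where n = n]\<close>)+

lemma cd_mult_one:
  "x \<in> cd_alg n \<Longrightarrow> cd_one n * x = x \<and> x * cd_one n = x"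
  by (induction n arbitrary: x)
     (auto elim!: cd_alg_SucE simp: cd_mult_zero cd_add_zero)

text \<open>By induction conjugation reverses both products in the first component; in the second,
  the two terms of the negated sum trade places.\<close>

lemma cd_conj_mult:
  "x \<in> cd_alg n \<Longrightarrow> y \<in> cd_alg n \<Longrightarrow> cd_conj (x * y) = cd_conj y * cd_conj x"
proof (induction n arbitrary: x y)
  case 0
  then show ?case by auto
next
  case (Suc n)
  obtain a b c d where eq: "x = CDPair a b" "y = CDPair c d"
    and mem: "a \<in> cd_alg n" "b \<in> cd_alg n" "c \<in> cd_alg n" "d \<in> cd_alg n"
    using Suc.prems by auto
  have *: "- (u + v) = - v + - u" if "u \<in> cd_alg n" "v \<in> cd_alg n" for u v :: cd
    by (rule cd_eqI[where n = n]) (use that in \<open>simp_all add: cd_coord_linear[where n = n]\<close>)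
  show ?case
    using mem by (simp add: eq Suc.IH cd_conj_diff[where n = n] cd_mult_minus[where n = n] *)
qed

section \<open>Real parts and imaginary elements\<close>

lemma cd_re_add:
  "x \<in> cd_alg n \<Longrightarrow> y \<in> cd_alg n \<Longrightarrow> cd_re (x + y) = cd_re x + cd_re y"
  by (induction n arbitrary: x y) auto

lemma cd_re_scaleR [simp]: "cd_re (t *\<^sub>R x) = t * cd_re x"
  by (induction x) auto

lemma cd_re_uminus [simp]: "cd_re (- x) = - cd_re x"
  by (induction x) auto

lemma cd_re_diff:
  "x \<in> cd_alg n \<Longrightarrow> y \<in> cd_alg n \<Longrightarrow> cd_re (x - y) = cd_re x - cd_re y"
  by (simp add: minus_cd_def cd_re_add[where n = n])

lemma cd_re_one [simp]: "cd_re (cd_one n) = 1"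
  by (induction n) auto

lemma cd_re_conj [simp]: "cd_re (cd_conj x) = cd_re x"
  by (induction x) auto

text \<open>The second halves cancel at every level, leaving twice the leftmost leaf.\<close>

lemma cd_add_conj: "x \<in> cd_alg n \<Longrightarrow> x + cd_conj x = (2 * cd_re x) *\<^sub>R cd_one n"
proof (induction n arbitrary: x)
  case 0
  then show ?case by auto
next
  case (Suc n)
  have "b + - b = cd_zero n" if "b \<in> cd_alg n" for b
    by (rule cd_eqI[where n = n]) (use that in \<open>simp_all add: cd_coord_linear[where n = n]\<close>)
  with Suc show ?case by (auto elim!: cd_alg_SucE)
qed

lemma cd_conj_imaginary:
  assumes "x \<in> cd_alg n" "cd_re x = 0"
  shows "cd_conj x = - x"
proof (rule cd_eqI[where n = n])
  fix s
  have "cd_coord (x + cd_conj x) s = 0"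
    using assms by (simp add: cd_add_conj[where n = n])
  then show "cd_coord (cd_conj x) s = cd_coord (- x) s"
    using assms by (simp add: cd_coord_add[where n = n])
qed (use assms in auto)

text \<open>Induction handles \<open>a * c\<close>. Conjugation keeps the real part and reverses
  products, so it turns \<open>cd_conj d * b\<close> into \<open>cd_conj b * d\<close>, the matching
  term of \<open>y * x\<close>.\<close>

lemma cd_re_mult_commute:
  "x \<in> cd_alg n \<Longrightarrow> y \<in> cd_alg n \<Longrightarrow> cd_re (x * y) = cd_re (y * x)"
proof (induction n arbitrary: x y)
  case 0
  then show ?case by auto
next
  case (Suc n)
  obtain a b c d where eq: "x = CDPair a b" "y = CDPair c d"
    and mem: "a \<in> cd_alg n" "b \<in> cd_alg n" "c \<in> cd_alg n" "d \<in> cd_alg n"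
    using Suc.prems by auto
  have "cd_re (cd_conj d * b) = cd_re (cd_conj (cd_conj d * b))"
    by simp
  also have "\<dots> = cd_re (cd_conj b * d)"
    using mem by (simp add: cd_conj_mult[where n = n] del: cd_re_conj)
  finally show ?case
    using mem by (simp add: eq Suc.IH[of a c] cd_re_diff[where n = n])
qed

section \<open>Orthogonal projections\<close>

lemma cd_inner_eq:
  assumes "x \<in> cd_alg n" "y \<in> cd_alg n"
  shows "cd_inner n x y = cd_re (x * cd_conj y)"
proof -
  have "cd_Re (x * cd_conj y) = cd_re (x * cd_conj y) *\<^sub>R cd_one n"
    using assms by (simp add: cd_Re_def cd_add_conj[where n = n])
  \<comment> \<open>Uniqueness for the \<open>THE\<close> in \<open>cd_inner\<close>:
    \<open>cd_re\<close> recovers the coefficient.\<close>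
  moreover have "r = s" if "r *\<^sub>R cd_one n = s *\<^sub>R cd_one n" for r s
    using arg_cong[OF that, of cd_re] by simp
  ultimately show ?thesis
    unfolding cd_inner_def by (intro the_equality) auto
qed

text \<open>The squared norm adds up over the two halves. Nonnegativity is carried along because it
  lets a vanishing sum force both summands to vanish.\<close>

lemma cd_inner_self:
  "x \<in> cd_alg n \<Longrightarrow> cd_re (x * cd_conj x) \<ge> 0 \<and> (cd_re (x * cd_conj x) = 0 \<longrightarrow> x = cd_zero n)"
proof (induction n arbitrary: x)
  case 0
  then show ?case by auto
next
  case (Suc n)
  obtain a b where eq: "x = CDPair a b" and mem: "a \<in> cd_alg n" "b \<in> cd_alg n"
    using Suc.prems by auto
  have "cd_re (x * cd_conj x) = cd_re (a * cd_conj a) + cd_re (b * cd_conj b)"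
    using mem by (simp add: eq cd_re_diff[where n = n] cd_mult_minus[where n = n]
        cd_re_mult_commute[where n = n and x = "cd_conj b"])
  with Suc.IH[OF mem(1)] Suc.IH[OF mem(2)] show ?case
    by (auto simp: eq)
qed

lemma cd_inner_diff:
  assumes "x \<in> cd_alg n" "y \<in> cd_alg n" "z \<in> cd_alg n"
  shows "cd_inner n (x - y) z = cd_inner n x z - cd_inner n y z"
  using assms by (simp add: cd_inner_eq cd_diff_distrib[where n = n] cd_re_diff[where n = n])

text \<open>If \<open>p\<close> and \<open>q\<close> both qualify, \<open>q - p\<close> lies in
  \<open>S\<close> and is orthogonal to itself, hence zero by definiteness. Computing a projection
  thus reduces to checking a candidate.\<close>

lemma cd_orth_proj_eqI:
  assumes S: "S \<subseteq> cd_alg n" "\<And>u v. u \<in> S \<Longrightarrow> v \<in> S \<Longrightarrow> u - v \<in> S"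
    and x: "x \<in> cd_alg n" and p: "p \<in> S" "\<And>s. s \<in> S \<Longrightarrow> cd_inner n (x - p) s = 0"
  shows "cd_orth_proj n S x = p"
  unfolding cd_orth_proj_def
proof (rule the_equality)
  fix q assume q: "q \<in> S \<and> (\<forall>s\<in>S. cd_inner n (x - q) s = 0)"
  have mem: "p \<in> cd_alg n" "q \<in> cd_alg n" and pq: "q - p \<in> S"
    using S p q by auto
  have "cd_inner n (q - p) (q - p) = cd_inner n (x - p) (q - p) - cd_inner n (x - q) (q - p)"
    using mem x by (simp add: cd_inner_diff)
  also have "\<dots> = 0"
    using p q pq by simp
  finally have "q - p = cd_zero n"
    using cd_inner_self[of "q - p" n] mem by (simp add: cd_inner_eq)
  then have "cd_coord (q - p) s = 0" for s
    by simp
  then show "q = p"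
    using mem by (intro cd_eqI[where n = n]) (auto simp: cd_coord_diff[where n = n])
qed (use p in auto)

section \<open>The complex plane, its complement and both projections in components\<close>

lemma cd_Cn_Suc: "cd_Cn (Suc n) = {CDPair (r *\<^sub>R cd_one n) (s *\<^sub>R cd_one n) | r s. True}"
  by (simp add: cd_Cn_def cd_add_zero)

lemma cd_inner_Cn:
  assumes "p \<in> cd_alg n" "q \<in> cd_alg n"
  shows "cd_inner (Suc n) (CDPair p q) (CDPair (r *\<^sub>R cd_one n) (s *\<^sub>R cd_one n)) =
    r * cd_re p + s * cd_re q"
  using assms by (simp add: cd_inner_eq cd_re_diff[where n = n] cd_mult_minus[where n = n]
      cd_scaleR_mult[where n = n] cd_mult_scaleR_right[where n = n] cd_mult_one)

lemma cd_Cperp_Suc: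
  "cd_Cperp (Suc n) = {CDPair p q | p q. p \<in> cd_alg n \<and> q \<in> cd_alg n \<and> cd_re p = 0 \<and> cd_re q = 0}"
proof -
  have *: "(\<forall>r s. r * u + s * v = 0) \<longleftrightarrow> u = 0 \<and> v = 0" for u v :: real
    by (metis add_0 add.right_neutral mult_1 mult_zero_left mult_zero_right)
  have **: "(\<forall>c\<in>cd_Cn (Suc n). cd_inner (Suc n) (CDPair p q) c = 0) \<longleftrightarrow> cd_re p = 0 \<and> cd_re q = 0"
    if "p \<in> cd_alg n" "q \<in> cd_alg n" for p q
    unfolding *[symmetric] using cd_inner_Cn[OF that] by (force simp: cd_Cn_Suc)
  show ?thesis
    unfolding cd_Cperp_def using ** by fastforce
qed

lemma cd_inner_commute:
  assumes "x \<in> cd_alg n" "y \<in> cd_alg n"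
  shows "cd_inner n x y = cd_inner n y x"
proof -
  have "cd_re (x * cd_conj y) = cd_re (cd_conj (x * cd_conj y))"
    by simp
  also have "\<dots> = cd_re (y * cd_conj x)"
    using assms by (simp add: cd_conj_mult[where n = n] del: cd_re_conj)
  finally show ?thesis
    using assms by (simp add: cd_inner_eq)
qed

lemma cd_piC_Pair:
  assumes "u \<in> cd_alg n" "v \<in> cd_alg n"
  shows "cd_piC (Suc n) (CDPair u v) = CDPair (cd_re u *\<^sub>R cd_one n) (cd_re v *\<^sub>R cd_one n)"
  unfolding cd_piC_def
proof (rule cd_orth_proj_eqI)
  have "r *\<^sub>R cd_one n - s *\<^sub>R cd_one n = (r - s) *\<^sub>R cd_one n" for r s
    by (rule cd_eqI[where n = n]) (simp_all add: cd_coord_linear[where n = n] algebra_simps)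
  then show "a - b \<in> cd_Cn (Suc n)" if "a \<in> cd_Cn (Suc n)" "b \<in> cd_Cn (Suc n)" for a b
    using that by (auto simp: cd_Cn_Suc)
qed (use assms in \<open>auto simp: cd_Cn_Suc cd_inner_Cn cd_re_diff[where n = n]\<close>)

lemma cd_piCperp_Pair:
  assumes "u \<in> cd_alg n" "v \<in> cd_alg n"
  shows "cd_piCperp (Suc n) (CDPair u v) =
    CDPair (u - cd_re u *\<^sub>R cd_one n) (v - cd_re v *\<^sub>R cd_one n)" (is "_ = ?p")
  unfolding cd_piCperp_def
proof (rule cd_orth_proj_eqI)
  have *: "w - (w - z) = z" if "w \<in> cd_alg n" "z \<in> cd_alg n" for w z :: cd
    by (rule cd_eqI[where n = n]) (use that in \<open>simp_all add: cd_coord_linear[where n = n]\<close>)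
  fix s assume "s \<in> cd_Cperp (Suc n)"
  then show "cd_inner (Suc n) (CDPair u v - ?p) s = 0"
    \<comment> \<open>The residue is the pair of real parts, an element of
      \<open>cd_Cn (Suc n)\<close>; symmetry moves it to the second argument, where
      \<open>cd_inner_Cn\<close> applies.\<close>
    using assms by (subst cd_inner_commute) (auto simp: cd_Cperp_Suc * cd_inner_Cn)
qed (use assms in \<open>auto simp: cd_Cperp_Suc cd_re_diff[where n = n]\<close>)

lemma cd_piC_tilde_Pair:
  assumes "u \<in> cd_alg n" "v \<in> cd_alg n"
  shows "cd_piC_tilde (Suc n) (CDPair u v) =
    CDPair (CDPair (cd_re u *\<^sub>R cd_one n) (cd_zero n)) (CDPair (cd_re v *\<^sub>R cd_one n) (cd_zero n))"
proof -
  \<comment> \<open>An element of the plane determines its two coefficients, so the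
    \<open>THE\<close> in \<open>cd_C_shift\<close> has exactly one candidate.\<close>
  have [simp]: "r *\<^sub>R cd_one n = s *\<^sub>R cd_one n \<longleftrightarrow> r = s" for r s
    using cd_re_scaleR[of _ "cd_one n"] by (metis cd_re_one mult_1_right)
  show ?thesis
    using assms unfolding cd_piC_tilde_def cd_C_shift_def
    by (simp add: cd_piC_Pair cd_add_zero)
qed

section \<open>The product formula\<close>

text \<open>Left multiplication by \<open>cd_i (Suc n)\<close> sends \<open>(p, q)\<close> to
  \<open>(- cd_conj q, cd_conj p)\<close>, which is \<open>(q, - p)\<close> for imaginary
  \<open>p\<close> and \<open>q\<close>.\<close>

lemma cd_brace_Pair:
  assumes "a1 \<in> cd_alg n" "a2 \<in> cd_alg n" "b1 \<in> cd_alg n" "b2 \<in> cd_alg n"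
    and "cd_re a1 = 0" "cd_re a2 = 0" "cd_re b1 = 0" "cd_re b2 = 0"
  shows "cd_brace (Suc n) (CDPair a1 a2) (CDPair b1 b2) = (1 / sqrt 2) *\<^sub>R
    CDPair (CDPair (a1 + b1) (a2 + b2)) (CDPair (b2 - a2) (a1 - b1))"
proof -
  have conj: "cd_conj (- a1 + b1) = a1 - b1" "cd_conj (- a2 + b2) = - (b2 - a2)"
    by (rule cd_eqI[where n = n];
        use assms in \<open>simp add: cd_conj_add[where n = n] cd_conj_imaginary[where n = n]
          cd_coord_linear[where n = n]\<close>)+
  show ?thesis
    using assms
    by (simp add: cd_brace_def conj cd_mult_zero cd_mult_one cd_add_zero)
qed

text \<open>As an unrestricted rewrite rule this would loop; the main proof uses instances that fix
  which factor comes first.\<close>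

lemma cd_mult_swap_imaginary:
  assumes "x \<in> cd_alg n" "y \<in> cd_alg n" "cd_re x = 0" "cd_re y = 0"
  shows "y * x = (2 * cd_re (x * y)) *\<^sub>R cd_one n - x * y"
proof -
  have "cd_conj (x * y) = y * x"
    using assms by (simp add: cd_conj_mult[where n = n] cd_conj_imaginary[where n = n]
        cd_mult_minus[where n = n])
  then have "x * y + y * x = (2 * cd_re (x * y)) *\<^sub>R cd_one n"
    using assms cd_add_conj[of "x * y" n] by simp
  \<comment> \<open>Moving \<open>x * y\<close> to the other side is done in coordinates, where the
    group laws of the reals are available.\<close>
  then have "cd_coord (x * y + y * x) s = cd_coord ((2 * cd_re (x * y)) *\<^sub>R cd_one n) s" for s
    by simp
  then have "cd_coord (x * y) s + cd_coord (y * x) s =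
      2 * cd_re (x * y) * cd_coord (cd_one n) s" for s
    using assms by (simp add: cd_coord_add[where n = n])
  then show ?thesis
    using assms by (intro cd_eqI[where n = n]) (simp_all add: cd_coord_diff[where n = n] algebra_simps)
qed

theorem theorem4p5:
  fixes n :: nat and a b x y :: cd
  assumes "n \<ge> 1"
    and "a \<in> cd_Cperp n" and "b \<in> cd_Cperp n"
    and "x \<in> cd_Cperp n" and "y \<in> cd_Cperp n"
  shows "cd_brace n a b * cd_brace n x y =
      sqrt 2 *\<^sub>R cd_brace n (cd_piCperp n (a * x)) (cd_piCperp n (b * y))
      + cd_piC_tilde n (x * a + b * y)
      + cd_piC_tilde n (a * y - x * b) * CDPair (cd_zero n) (cd_i n)"
proof -
  obtain m where n: "n = Suc m"
    using assms(1) by (cases n) auto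
  obtain a1 a2 b1 b2 x1 x2 y1 y2 where
    eq: "a = CDPair a1 a2" "b = CDPair b1 b2" "x = CDPair x1 x2" "y = CDPair y1 y2"
    and mem [simp]: "a1 \<in> cd_alg m" "a2 \<in> cd_alg m" "b1 \<in> cd_alg m" "b2 \<in> cd_alg m"
      "x1 \<in> cd_alg m" "x2 \<in> cd_alg m" "y1 \<in> cd_alg m" "y2 \<in> cd_alg m"
    and re [simp]: "cd_re a1 = 0" "cd_re a2 = 0" "cd_re b1 = 0" "cd_re b2 = 0"
      "cd_re x1 = 0" "cd_re x2 = 0" "cd_re y1 = 0" "cd_re y2 = 0"
    using assms(2-5) unfolding n cd_Cperp_Suc by blast
  have conj [simp]: "cd_conj a1 = - a1" "cd_conj a2 = - a2" "cd_conj b1 = - b1" "cd_conj b2 = - b2"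
      "cd_conj x1 = - x1" "cd_conj x2 = - x2" "cd_conj y1 = - y1" "cd_conj y2 = - y2"
    by (simp_all add: cd_conj_imaginary[where n = m])
  note alg = cd_conj_add[where n = m] cd_conj_diff[where n = m] cd_mult_minus[where n = m]
    cd_distrib_left[where n = m] cd_distrib_right[where n = m] cd_diff_distrib[where n = m]
    cd_scaleR_mult[where n = m] cd_mult_scaleR_right[where n = m] cd_mult_zero[where n = m]
    cd_mult_one[where n = m] cd_add_zero[where n = m]
    cd_re_diff[where n = m] cd_re_add[where n = m]
  txt \<open>
    Once every product has its left factor from \<open>a, b\<close> and its right factor from \<open>x, y\<close>, the
    claim is linear in the products and their real parts.
  \<close>
  note swap =
    cd_mult_swap_imaginary[where n = m and x = a1 and y = x1]
    cd_mult_swap_imaginary[where n = m and x = a1 and y = x2]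
    cd_mult_swap_imaginary[where n = m and x = a2 and y = x1]
    cd_mult_swap_imaginary[where n = m and x = a2 and y = x2]
    cd_mult_swap_imaginary[where n = m and x = a1 and y = y1]
    cd_mult_swap_imaginary[where n = m and x = a1 and y = y2]
    cd_mult_swap_imaginary[where n = m and x = a2 and y = y1]
    cd_mult_swap_imaginary[where n = m and x = a2 and y = y2]
    cd_mult_swap_imaginary[where n = m and x = b1 and y = x1]
    cd_mult_swap_imaginary[where n = m and x = b1 and y = x2]
    cd_mult_swap_imaginary[where n = m and x = b2 and y = x1]
    cd_mult_swap_imaginary[where n = m and x = b2 and y = x2]
    cd_mult_swap_imaginary[where n = m and x = b1 and y = y1]
    cd_mult_swap_imaginary[where n = m and x = b1 and y = y2]
    cd_mult_swap_imaginary[where n = m and x = b2 and y = y1]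
    cd_mult_swap_imaginary[where n = m and x = b2 and y = y2]
  let ?B = "\<lambda>a1 a2 b1 b2. CDPair (CDPair (a1 + b1) (a2 + b2)) (CDPair (b2 - a2) (a1 - b1))"
  \<comment> \<open>The scalars of the two braces combine to \<open>1 / 2\<close> before the product
    is expanded; on the right, \<open>sqrt 2\<close> cancels against the scalar of its
    brace.\<close>
  have half: "1 / sqrt 2 * (1 / sqrt 2) = 1 / (2 :: real)"
    by simp
  have "(t *\<^sub>R u) * (t *\<^sub>R v) = (t * t) *\<^sub>R (u * v)"
    if "u \<in> cd_alg (Suc (Suc m))" "v \<in> cd_alg (Suc (Suc m))" for t u v
    using that by (simp add: cd_scaleR_mult[where n = "Suc (Suc m)"]
        cd_mult_scaleR_right[where n = "Suc (Suc m)"] del: cd_alg.simps)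
  then have "cd_brace n a b * cd_brace n x y =
      (1 / sqrt 2 * (1 / sqrt 2)) *\<^sub>R (?B a1 a2 b1 b2 * ?B x1 x2 y1 y2)"
    unfolding n eq by (simp add: cd_brace_Pair del: times_cd.simps scaleR_cd.simps)
  also have "\<dots> = (1 / 2) *\<^sub>R (?B a1 a2 b1 b2 * ?B x1 x2 y1 y2)"
    unfolding half ..
  finally have lhs: "cd_brace n a b * cd_brace n x y = \<dots>" .
  show ?thesis
    unfolding lhs unfolding n eq
    \<comment> \<open>Four equations in \<open>cd_alg m\<close> remain. The first
      \<open>cd_piC_tilde\<close> term has the form \<open>((r, 0), (s, 0))\<close>; multiplying
      such an element by \<open>(0, i)\<close> gives \<open>((0, s), (0, r))\<close>. So each
      component receives one real-part correction, and the coordinates of the products act as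
      unknowns in a linear identity.\<close>
    by (simp add: cd_brace_Pair cd_piCperp_Pair cd_piC_tilde_Pair alg, intro conjI;
        rule cd_eqI[where n = m]; simp add: swap cd_coord_linear[where n = m] alg;
        simp add: field_simps)
qed

end
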